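(* Let an instance of the convex projection problem (CPP) be given by $G\in\mathbb{R}^{q\times n}$ and $g_1,\dots,g_m$, with feasible set $X$ and $Y=\{Gx : x\in X\}\subseteq\mathbb{R}^q$. Let $\varepsilon>0$, and let $\mathcal{P}_{outer}$ be the result of the primal Benson type algorithm (described in the context) applied with tolerance $\varepsilon$ to the associated multiobjective convex program (MOCP). Let $Y_{outer} := \pi[\mathcal{P}_{outer}\cap H]$. Then $Y_{outer}\supseteq Y$ and $$d_H(Y_{outer},Y)\le \varepsilon\sqrt{q^2+q-1}.$$
   Context: Notation: $e$ is the all-ones vector of appropriate dimension, $e^i$ the $i$-th unit vector, inequalities between vectors are componentwise, $\mathbb{R}^{q+1}_+=\{y\in\mathbb{R}^{q+1}: y\ge 0\}$. $\pi:\mathbb{R}^{q+1}\to\mathbb{R}^q$ omits the last component, and $\pi[A]=\{\pi(a):a\in A\}$. $H=\{y\in\mathbb{R}^{q+1}: e^Ty=0\}$. $d_H$ is the Hausdorff distance with respect to the Euclidean norm; for nonempty $M\subseteq N$ it equals $d_H(M,N)=\sup_{b\in N}\inf_{a\in M}\|a-b\|_2$ (and $d_H(N,M)=d_H(M,N)$). Problem (CPP): $G\in\mathbb{R}^{q\times n}$ has full row rank; $g_1,\dots,g_m:\mathbb{R}^n\to\mathbb{R}\cup\{\infty\}$ are convex, $g=(g_1,\dots,g_m)^T$; the feasible set $X=\{x\in\mathbb{R}^n: g_1(x)\le 0,\dots,g_m(x)\le 0\}$ is assumed to be a convex body (convex, compact, with nonempty interior); the set to be approximated is $Y=\{Gx: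 x\in X\}$. Associated (MOCP): minimize $\Gamma(x)=\begin{pmatrix}Gx\\ -e^TGx\end{pmatrix}\in\mathbb{R}^{q+1}$ with respect to the componentwise order subject to $x\in X$. Its upper image is $\mathcal{P}=\Gamma[X]+\mathbb{R}^{q+1}_+$, where $\Gamma[X]=\{\Gamma(x):x\in X\}$. Scalarization: for $v\in\mathbb{R}^{q+1}$, $(P_2(v))$ is the problem $\min_{x\in\mathbb{R}^n,z\in\mathbb{R}} z$ subject to $g(x)\le 0$, $\Gamma(x)-ze-v\le 0$. Its Lagrangian dual $(D_2(v))$ is $\max_{u\in\mathbb{R}^m,w\in\mathbb{R}^{q+1}}\ \inf_{x\in\mathbb{R}^n}[w^T\Gamma(x)+u^Tg(x)]-w^Tv$ subject to $u\ge 0$, $w\ge 0$, $w^Te=1$ (with $0\cdot\infty:=0$). Primal Benson type algorithm with tolerance $\varepsilon>0$: (1) Let $y_i=\min_{x\in X}\Gamma_i(x)$ for $i=1,\dots,q+1$, $y=(y_1,\dots,y_{q+1})^T$, and $\mathcal{P}_0=\{y\}+\mathbb{R}^{q+1}_+$. Set $V:=\emptyset$, $\mathcal{P}_{outer}:=\mathcal{P}_0$, and let $\bar V$ be the vertex set of $\mathcal{P}_{outer}$. (2) While $\bar V\setminus V\ne\emptyset$: choose any $v\in\bar V\setminus V$; compute an optimal solution $(x,z)$ of $(P_2(v))$ and an optimal solution $(u,w)$ of $(D_2(v))$; if $z>\varepsilon$, replace $\mathcal{P}_{outer}$ by $\mathcal{P}_{outer}\cap\{y\in\mathbb{R}^{q+1}: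 w^Ty\ge \inf_{x\in X}w^T\Gamma(x)\}$ and let $\bar V$ be the vertex set of the new $\mathcal{P}_{outer}$; otherwise replace $V$ by $V\cup\{v\}$. (3) When the loop ends, return $\mathcal{P}_{outer}$. The "result" of the algorithm is the set $\mathcal{P}_{outer}$ returned upon termination. *)

theory Defs
  imports "HOL-Analysis.Analysis"
begin

text \<open>
  Encoding.  The space of \<open>q + 1\<close> coordinates is \<open>real ^ 'q option\<close>, where \<open>None\<close> is the index of the
  last coordinate.  The all-ones vector is the constant \<open>1\<close> of type \<open>real ^ 'i\<close>, and \<open>\<le>\<close> on
  \<open>real ^ 'i\<close> is the componentwise order.
\<close>

definition ext_convex :: "(real ^ 'n \<Rightarrow> ereal) \<Rightarrow> bool" where
  "ext_convex f \<longleftrightarrow>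
     (\<forall>x. f x \<noteq> -\<infinity>) \<and>
     (\<forall>x y t. 0 < t \<longrightarrow> t < 1 \<longrightarrow>
        f ((1 - t) *\<^sub>R x + t *\<^sub>R y) \<le> ereal (1 - t) * f x + ereal t * f y)"

definition convex_body :: "(real ^ 'n) set \<Rightarrow> bool" where
  "convex_body S \<longleftrightarrow> convex S \<and> compact S \<and> interior S \<noteq> {}"

text \<open>
  Taking values in \<open>ennreal\<close> avoids the junk values that suprema of unbounded sets of reals have.
\<close>

definition hausdorff_distance :: "'a::metric_space set \<Rightarrow> 'a set \<Rightarrow> ennreal" where
  "hausdorff_distance A B =
     max (SUP a\<in>A. INF b\<in>B. ennreal (dist a b)) (SUP b\<in>B. INF a\<in>A. ennreal (dist a b))"

definition feasible_set :: "('m \<Rightarrow> real ^ 'n \<Rightarrow> ereal) \<Rightarrow> (real ^ 'n) set" where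
  "feasible_set g = {x. \<forall>j. g j x \<le> 0}"

definition is_CPP :: "real ^ 'n ^ 'q \<Rightarrow> ('m::finite \<Rightarrow> real ^ 'n \<Rightarrow> ereal) \<Rightarrow> bool" where
  "is_CPP G g \<longleftrightarrow>
     rank G = CARD('q) \<and> (\<forall>j. ext_convex (g j)) \<and> convex_body (feasible_set g)"

definition projected_set :: "real ^ 'n ^ 'q \<Rightarrow> ('m \<Rightarrow> real ^ 'n \<Rightarrow> ereal) \<Rightarrow> (real ^ 'q) set" where
  "projected_set G g = (\<lambda>x. G *v x) ` feasible_set g"

definition omit_last :: "real ^ ('q::finite) option \<Rightarrow> real ^ 'q" where
  "omit_last y = (\<chi> i. y $ Some i)"

definition sum_zero_hyperplane :: "(real ^ ('q::finite) option) set" where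
  "sum_zero_hyperplane = {y. 1 \<bullet> y = 0}"

definition mocp_objective :: "real ^ 'n ^ 'q \<Rightarrow> real ^ 'n \<Rightarrow> real ^ ('q::finite) option" where
  "mocp_objective G x =
     (\<chi> i. case i of Some j \<Rightarrow> (G *v x) $ j | None \<Rightarrow> - (1 \<bullet> (G *v x)))"

definition P2_feasible ::
  "real ^ 'n ^ 'q \<Rightarrow> ('m \<Rightarrow> real ^ 'n \<Rightarrow> ereal) \<Rightarrow> real ^ ('q::finite) option \<Rightarrow> (real ^ 'n) \<times> real \<Rightarrow> bool" where
  "P2_feasible G g v = (\<lambda>(x, z). (\<forall>j. g j x \<le> 0) \<and> mocp_objective G x - z *\<^sub>R 1 - v \<le> 0)"

definition P2_optimal ::
  "real ^ 'n ^ 'q \<Rightarrow> ('m \<Rightarrow> real ^ 'n \<Rightarrow> ereal) \<Rightarrow> real ^ ('q::finite) option \<Rightarrow> (real ^ 'n) \<times> real \<Rightarrow> bool" where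
  "P2_optimal G g v = is_arg_min (\<lambda>(x, z). z) (P2_feasible G g v)"

definition D2_feasible :: "(real ^ 'm) \<times> (real ^ ('q::finite) option) \<Rightarrow> bool" where
  "D2_feasible = (\<lambda>(u, w). 0 \<le> u \<and> 0 \<le> w \<and> w \<bullet> 1 = 1)"

text \<open>
  Multiplication on \<open>ereal\<close> satisfies \<open>0 * \<infinity> = 0\<close>.  For \<open>u \<ge> 0\<close> and \<open>g\<close> never \<open>-\<infinity>\<close>, no sum below
  is of the form \<open>\<infinity> - \<infinity>\<close>.
\<close>

definition D2_objective ::
  "real ^ 'n ^ 'q \<Rightarrow> ('m::finite \<Rightarrow> real ^ 'n \<Rightarrow> ereal) \<Rightarrow> real ^ ('q::finite) option
    \<Rightarrow> (real ^ 'm) \<times> (real ^ ('q::finite) option) \<Rightarrow> ereal" where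
  "D2_objective G g v = (\<lambda>(u, w).
     (INF x. ereal (w \<bullet> mocp_objective G x) + (\<Sum>j\<in>UNIV. ereal (u $ j) * g j x)) - ereal (w \<bullet> v))"

definition D2_optimal ::
  "real ^ 'n ^ 'q \<Rightarrow> ('m::finite \<Rightarrow> real ^ 'n \<Rightarrow> ereal) \<Rightarrow> real ^ ('q::finite) option
    \<Rightarrow> (real ^ 'm) \<times> (real ^ ('q::finite) option) \<Rightarrow> bool" where
  "D2_optimal G g v = is_arg_max (D2_objective G g v) D2_feasible"

definition vertices :: "(real ^ 'i) set \<Rightarrow> (real ^ 'i) set" where
  "vertices P = {v. v extreme_point_of P}"

text \<open>
  \<open>LEAST\<close> is the minimum, which is attained because the feasible set is compact and nonempty.
\<close>

definition ideal_point ::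
  "real ^ 'n ^ 'q \<Rightarrow> ('m \<Rightarrow> real ^ 'n \<Rightarrow> ereal) \<Rightarrow> real ^ ('q::finite) option" where
  "ideal_point G g = (\<chi> i. LEAST t. t \<in> (\<lambda>x. mocp_objective G x $ i) ` feasible_set g)"

definition initial_outer ::
  "real ^ 'n ^ 'q \<Rightarrow> ('m \<Rightarrow> real ^ 'n \<Rightarrow> ereal) \<Rightarrow> (real ^ ('q::finite) option) set" where
  "initial_outer G g = {ideal_point G g + r |r. 0 \<le> r}"

definition supporting_halfspace ::
  "real ^ 'n ^ 'q \<Rightarrow> ('m \<Rightarrow> real ^ 'n \<Rightarrow> ereal) \<Rightarrow> real ^ ('q::finite) option \<Rightarrow> (real ^ ('q::finite) option) set" where
  "supporting_halfspace G g w = {y. w \<bullet> y \<ge> (INF x\<in>feasible_set g. w \<bullet> mocp_objective G x)}"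

text \<open>
  \<open>benson_reachable G g \<epsilon> V P\<close>: some run of the primal Benson type algorithm reaches the loop head
  with accepted vertices \<open>V\<close> and outer approximation \<open>P\<close>.  The algorithm's third variable is always
  \<open>vertices P\<close>.  The choices of the vertex and of the optimal solutions are nondeterministic.
\<close>

inductive benson_reachable ::
  "real ^ 'n ^ 'q \<Rightarrow> ('m::finite \<Rightarrow> real ^ 'n \<Rightarrow> ereal) \<Rightarrow> real
    \<Rightarrow> (real ^ ('q::finite) option) set \<Rightarrow> (real ^ ('q::finite) option) set \<Rightarrow> bool"
  for G g \<epsilon> where
  init: "benson_reachable G g \<epsilon> {} (initial_outer G g)"
| cut: "benson_reachable G g \<epsilon> V (P \<inter> supporting_halfspace G g w)"
  if "benson_reachable G g \<epsilon> V P" and "v \<in> vertices P - V"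
    and "P2_optimal G g v (x, z)" and "D2_optimal G g v (u, w)" and "z > \<epsilon>"
| accept: "benson_reachable G g \<epsilon> (V \<union> {v}) P"
  if "benson_reachable G g \<epsilon> V P" and "v \<in> vertices P - V"
    and "P2_optimal G g v (x, z)" and "D2_optimal G g v (u, w)" and "\<not> z > \<epsilon>"

definition benson_result ::
  "real ^ 'n ^ 'q \<Rightarrow> ('m::finite \<Rightarrow> real ^ 'n \<Rightarrow> ereal) \<Rightarrow> real
    \<Rightarrow> (real ^ ('q::finite) option) set \<Rightarrow> bool" where
  "benson_result G g \<epsilon> P \<longleftrightarrow> (\<exists>V. benson_reachable G g \<epsilon> V P \<and> vertices P - V = {})"

end

theory Submission
  imports Defs
begin

text \<open>
  Write \<open>\<Gamma>\<close> for the objective, \<open>X\<close> for the feasible set and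
  \<open>Q = {y. \<exists>x\<in>X. \<Gamma> x \<le> y + \<epsilon> e}\<close> for the upper image shifted down by \<open>\<epsilon> e\<close>.
  Every cut of the algorithm is a half-space that supports \<open>\<Gamma> ` X\<close>, so
  \<open>\<Gamma> ` X \<subseteq> P_outer\<close> throughout; since \<open>\<Gamma> ` X\<close> lies in the hyperplane \<open>H\<close> and omitting the
  last coordinate of \<open>\<Gamma> x\<close> gives \<open>G x\<close>, this is the inclusion of \<open>Y\<close> in \<open>Y_outer\<close>.

  For the distance, an accepted vertex \<open>v\<close> has optimal value at most \<open>\<epsilon>\<close> in the scalarized problem,
  and this says exactly that \<open>v \<in> Q\<close>. On termination all vertices of \<open>P_outer\<close> therefore lie in
  \<open>Q\<close>, and the geometric core of the proof (lemma \<open>subset_if_extreme_points_subset\<close>) is that then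
  \<open>P_outer \<subseteq> Q\<close>. Indeed a point of \<open>P_outer\<close> outside the closed convex upper set \<open>Q\<close> could be
  separated from it by a functional \<open>w\<close> with strictly positive coordinates; because \<open>P_outer\<close> is
  bounded below, such a \<open>w\<close> attains its minimum over \<open>P_outer\<close> at a vertex, and that vertex would
  be outside \<open>Q\<close>.

  Hence each \<open>y \<in> P_outer \<inter> H\<close> has some \<open>x \<in> X\<close> for which \<open>d = y - \<Gamma> x\<close> has coordinates at least
  \<open>-\<epsilon>\<close> and coordinate sum \<open>0\<close>. These \<open>d\<close> form a simplex, on which the norm of the first \<open>q\<close>
  coordinates is largest at a vertex with one of those coordinates equal to \<open>q \<epsilon>\<close> and all the other
  coordinates equal to \<open>-\<epsilon>\<close>. There it is \<open>\<epsilon> \<surd>(q\<^sup>2 + (q - 1))\<close> (lemma \<open>norm_omit_last_le\<close>).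
\<close>

section \<open>Convex sets that are bounded below\<close>

text \<open>
  The functional has compact sublevel sets on \<open>P\<close>, so its set of minimizers is a nonempty compact
  face, and extreme points of a face are extreme in \<open>P\<close>.
\<close>

lemma extreme_point_below:
  fixes P :: "(real ^ 'i) set"
  assumes "closed P" and "convex P" and below: "\<And>y. y \<in> P \<Longrightarrow> l \<le> y"
    and w: "\<And>i. 0 < w $ i" and p: "p \<in> P"
  obtains v where "v extreme_point_of P" and "w \<bullet> v \<le> w \<bullet> p"
proof -
  define S where "S = P \<inter> {y. w \<bullet> y \<le> w \<bullet> p}"
  have "closed S"
    unfolding S_def by (intro closed_Int \<open>closed P\<close> closed_halfspace_le)
  have "S \<subseteq> cbox l (\<chi> i. l $ i + (w \<bullet> p - w \<bullet> l) / w $ i)"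
  proof
    fix y assume "y \<in> S"
    then have ly: "l $ i \<le> y $ i" for i
      using below by (auto simp: S_def less_eq_vec_def)
    have "y $ i \<le> l $ i + (w \<bullet> p - w \<bullet> l) / w $ i" for i
    proof -
      have "w $ i * (y $ i - l $ i) \<le> (\<Sum>j\<in>UNIV. w $ j * (y $ j - l $ j))"
        by (rule member_le_sum) (use ly w in \<open>auto simp: less_imp_le\<close>)
      also have "\<dots> = w \<bullet> y - w \<bullet> l"
        by (simp add: inner_vec_def right_diff_distrib sum_subtractf)
      also have "\<dots> \<le> w \<bullet> p - w \<bullet> l"
        using \<open>y \<in> S\<close> by (simp add: S_def)
      finally show ?thesis
        using w[of i] by (simp add: field_simps)
    qed
    then show "y \<in> cbox l (\<chi> i. l $ i + (w \<bullet> p - w \<bullet> l) / w $ i)"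
      using ly by (simp add: mem_box_cart)
  qed
  then have "bounded S"
    by (rule bounded_subset[OF bounded_cbox])
  then have "compact S"
    using \<open>closed S\<close> by (simp add: compact_eq_bounded_closed)
  moreover have "p \<in> S"
    using p by (simp add: S_def)
  ultimately obtain v0 where v0: "v0 \<in> S" "\<And>y. y \<in> S \<Longrightarrow> w \<bullet> v0 \<le> w \<bullet> y"
    using continuous_attains_inf[of S "\<lambda>y. w \<bullet> y"]
      continuous_on_inner[OF continuous_on_const continuous_on_id, of S w]
    by (metis empty_iff)
  have min: "w \<bullet> v0 \<le> w \<bullet> y" if "y \<in> P" for y
    using v0 that by (cases "w \<bullet> y \<le> w \<bullet> p") (auto simp: S_def)
  define F where "F = P \<inter> {y. w \<bullet> y = w \<bullet> v0}"
  have face: "F face_of P"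
    unfolding F_def by (rule face_of_Int_supporting_hyperplane_ge[OF \<open>convex P\<close>]) (rule min)
  have "F \<subseteq> S" "v0 \<in> F"
    using v0 by (auto simp: F_def S_def)
  moreover have "closed F"
    unfolding F_def by (intro closed_Int \<open>closed P\<close> closed_hyperplane)
  ultimately have "compact F"
    using \<open>bounded S\<close> bounded_subset compact_eq_bounded_closed by blast
  then obtain v where v: "v extreme_point_of F"
    using extreme_point_exists_convex[of F] face_of_imp_convex[OF face] \<open>v0 \<in> F\<close> by blast
  show thesis
  proof
    show "v extreme_point_of P"
      using v face extreme_point_of_face by blast
    have "v \<in> F"
      using v by (simp add: extreme_point_of_def)
    then show "w \<bullet> v \<le> w \<bullet> p"
      using min[OF p] by (simp add: F_def)
  qed
qed

text \<open>
  A functional that separates \<open>p\<close> from a nonempty \<open>Q\<close> is nonnegative because \<open>Q\<close> is closed under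
  going up. A small multiple of the all-ones vector makes it strictly positive, and the separation
  survives since \<open>1 \<bullet> c\<close> is bounded below for \<open>c \<in> Q\<close>.
\<close>

lemma positive_separation:
  fixes Q :: "(real ^ 'i) set"
  assumes "closed Q" and "convex Q" and below: "\<And>y. y \<in> Q \<Longrightarrow> l \<le> y"
    and up: "\<And>y y'. y \<in> Q \<Longrightarrow> y \<le> y' \<Longrightarrow> y' \<in> Q" and "p \<notin> Q"
  obtains w where "\<And>i. 0 < w $ i" and "\<And>c. c \<in> Q \<Longrightarrow> w \<bullet> p < w \<bullet> c"
proof (cases "Q = {}")
  case True
  then show thesis
    using that[of 1] by simp
next
  case False
  then obtain c0 where c0: "c0 \<in> Q" by blast
  obtain a b where ab: "a \<bullet> p < b" "\<And>c. c \<in> Q \<Longrightarrow> b < a \<bullet> c"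
    using separating_hyperplane_closed_point[OF \<open>convex Q\<close> \<open>closed Q\<close> \<open>p \<notin> Q\<close>] by blast
  have a: "0 \<le> a $ i" for i
  proof (rule ccontr)
    assume "\<not> 0 \<le> a $ i"
    then have neg: "a $ i < 0" by simp
    \<comment> \<open>moving from \<open>c0\<close> along the \<open>i\<close>-th axis by \<open>t\<close> would bring \<open>a\<close> down to \<open>b\<close>\<close>
    define t where "t = (b - a \<bullet> c0) / a $ i"
    have "0 \<le> t"
      using ab(2)[OF c0] neg by (simp add: t_def divide_nonpos_neg)
    then have "c0 + axis i t \<in> Q"
      by (intro up[OF c0]) (simp add: less_eq_vec_def axis_def)
    then have "b < a \<bullet> c0 + a $ i * t"
      using ab(2) by (fastforce simp: inner_add_right inner_axis)
    then show False
      using neg by (simp add: t_def)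
  qed
  \<comment> \<open>\<open>\<delta>\<close> makes the loss \<open>\<delta> * (1 \<bullet> p - 1 \<bullet> c)\<close> at most the gap \<open>b - a \<bullet> p\<close>; the summand \<open>1\<close> in
    \<open>s\<close> only keeps the divisor positive\<close>
  define s where "s = \<bar>1 \<bullet> p - 1 \<bullet> l\<bar> + 1"
  define \<delta> where "\<delta> = (b - a \<bullet> p) / s"
  have s: "0 < s" by (simp add: s_def add_nonneg_pos)
  then have \<delta>: "0 < \<delta>" using ab(1) by (simp add: \<delta>_def)
  show thesis
  proof
    show "0 < (a + \<delta> *\<^sub>R 1) $ i" for i
      using a[of i] \<delta> by simp
    show "(a + \<delta> *\<^sub>R 1) \<bullet> p < (a + \<delta> *\<^sub>R 1) \<bullet> c" if c: "c \<in> Q" for c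
    proof -
      have "1 \<bullet> l \<le> 1 \<bullet> c"
        using below[OF c] by (simp add: inner_vec_def less_eq_vec_def sum_mono)
      then have "\<delta> * (1 \<bullet> p - 1 \<bullet> c) \<le> \<delta> * s"
        using \<delta> by (intro mult_left_mono) (auto simp: s_def)
      also have "\<dots> = b - a \<bullet> p"
        using s by (simp add: \<delta>_def)
      finally show ?thesis
        using ab(2)[OF c] by (simp add: inner_add_left algebra_simps)
    qed
  qed
qed

text \<open>
  Minimizing a positive functional that separates a point of \<open>P\<close> from \<open>Q\<close> yields an extreme point
  of \<open>P\<close> that is also separated from \<open>Q\<close>.
\<close>

lemma subset_if_extreme_points_subset:
  fixes P Q :: "(real ^ 'i) set"
  assumes "closed P" "convex P" "\<And>y. y \<in> P \<Longrightarrow> l \<le> y"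
    and "closed Q" "convex Q" "\<And>y. y \<in> Q \<Longrightarrow> l' \<le> y"
    and "\<And>y y'. y \<in> Q \<Longrightarrow> y \<le> y' \<Longrightarrow> y' \<in> Q"
    and ext: "\<And>v. v extreme_point_of P \<Longrightarrow> v \<in> Q"
  shows "P \<subseteq> Q"
proof (rule ccontr)
  assume "\<not> P \<subseteq> Q"
  then obtain p where p: "p \<in> P" "p \<notin> Q" by blast
  obtain w where w: "\<And>i. 0 < w $ i" "\<And>c. c \<in> Q \<Longrightarrow> w \<bullet> p < w \<bullet> c"
    using positive_separation[of Q l' p] assms(4-7) p(2) by blast
  obtain v where "v extreme_point_of P" "w \<bullet> v \<le> w \<bullet> p"
    using extreme_point_below[of P l w p] assms(1-3) w(1) p(1) by blast
  then show False
    using ext w(2) by fastforce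
qed

section \<open>The objective and its shifted upper image\<close>

lemma sum_UNIV_option:
  fixes f :: "'q::finite option \<Rightarrow> real"
  shows "(\<Sum>i\<in>UNIV. f i) = f None + (\<Sum>i\<in>UNIV. f (Some i))"
  by (simp add: UNIV_option_conv sum.reindex)

lemma inner_one: "1 \<bullet> (y :: real ^ 'i) = (\<Sum>i\<in>UNIV. y $ i)"
  by (simp add: inner_vec_def)

lemma omit_last_mocp_objective: "omit_last (mocp_objective G x) = G *v x"
  by (simp add: omit_last_def mocp_objective_def vec_eq_iff)

lemma mocp_objective_in_hyperplane: "mocp_objective G x \<in> sum_zero_hyperplane"
  by (simp add: sum_zero_hyperplane_def inner_one sum_UNIV_option mocp_objective_def)

lemma linear_mocp_objective: "linear (mocp_objective G)"
proof (rule linearI)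
  show "mocp_objective G (x + y) = mocp_objective G x + mocp_objective G y" for x y
    by (simp add: mocp_objective_def vec_eq_iff matrix_vector_right_distrib inner_add_right
        split: option.split)
  show "mocp_objective G (c *\<^sub>R x) = c *\<^sub>R mocp_objective G x" for c x
    by (simp add: mocp_objective_def vec_eq_iff matrix_vector_mult_scaleR split: option.split)
qed

lemma compact_mocp_image:
  "compact (feasible_set g) \<Longrightarrow> compact (mocp_objective G ` feasible_set g)"
  by (intro compact_continuous_image linear_continuous_on linear_conv_bounded_linear[THEN iffD1]
      linear_mocp_objective)

definition shifted_upper_image ::
  "real ^ 'n ^ 'q \<Rightarrow> ('m \<Rightarrow> real ^ 'n \<Rightarrow> ereal) \<Rightarrow> real \<Rightarrow> (real ^ ('q::finite) option) set" where
  "shifted_upper_image G g \<epsilon> = {y. \<exists>x\<in>feasible_set g. mocp_objective G x \<le> y + \<epsilon> *\<^sub>R 1}"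

text \<open>
  Closedness follows from this form, the sum of a compact set and a closed orthant.
\<close>

lemma shifted_upper_image_eq_sum:
  "shifted_upper_image G g \<epsilon> =
    {k + r |k r. k \<in> mocp_objective G ` feasible_set g \<and> r \<in> {r. \<forall>i. - \<epsilon> \<le> r $ i}}"
proof (intro set_eqI iffI)
  fix y assume "y \<in> shifted_upper_image G g \<epsilon>"
  then obtain x where x: "x \<in> feasible_set g" "mocp_objective G x \<le> y + \<epsilon> *\<^sub>R 1"
    by (auto simp: shifted_upper_image_def)
  have "- \<epsilon> \<le> (y - mocp_objective G x) $ i" for i
    using x(2)[unfolded less_eq_vec_def, rule_format, of i] by simp
  moreover have "y = mocp_objective G x + (y - mocp_objective G x)"
    by simp
  ultimately show "y \<in> {k + r |k r. k \<in> mocp_objective G ` feasible_set g \<and> r \<in> {r. \<forall>i. - \<epsilon> \<le> r $ i}}"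
    using x(1) by blast
next
  fix y
  assume "y \<in> {k + r |k r. k \<in> mocp_objective G ` feasible_set g \<and> r \<in> {r. \<forall>i. - \<epsilon> \<le> r $ i}}"
  then obtain x r where x: "x \<in> feasible_set g" and y: "y = mocp_objective G x + r"
    and r: "\<And>i. - \<epsilon> \<le> r $ i"
    by blast
  have "0 \<le> r $ i + \<epsilon>" for i
    using r[of i] by linarith
  then have "mocp_objective G x \<le> y + \<epsilon> *\<^sub>R 1"
    by (simp add: y less_eq_vec_def add.assoc)
  then show "y \<in> shifted_upper_image G g \<epsilon>"
    using x by (auto simp: shifted_upper_image_def)
qed

lemma closed_shifted_upper_image:
  fixes G :: "real ^ 'n ^ 'q::finite"
  assumes "compact (feasible_set g)"
  shows "closed (shifted_upper_image G g \<epsilon>)"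
proof -
  have "closed {r :: real ^ 'q option. \<forall>i. - \<epsilon> \<le> r $ i}"
    by (intro closed_Collect_all closed_Collect_le continuous_intros)
  from compact_closed_sums[OF compact_mocp_image[OF assms] this] show ?thesis
    unfolding shifted_upper_image_eq_sum by (rule back_subst[of closed]) blast
qed

lemma convex_shifted_upper_image:
  fixes G :: "real ^ 'n ^ 'q::finite"
  assumes "convex (feasible_set g)"
  shows "convex (shifted_upper_image G g \<epsilon>)"
proof (rule convexI)
  fix y1 y2 and s t :: real
  assume y: "y1 \<in> shifted_upper_image G g \<epsilon>" "y2 \<in> shifted_upper_image G g \<epsilon>"
    and st: "0 \<le> s" "0 \<le> t" "s + t = 1"
  obtain x1 where x1: "x1 \<in> feasible_set g" "mocp_objective G x1 \<le> y1 + \<epsilon> *\<^sub>R 1"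
    using y(1) by (auto simp: shifted_upper_image_def)
  obtain x2 where x2: "x2 \<in> feasible_set g" "mocp_objective G x2 \<le> y2 + \<epsilon> *\<^sub>R 1"
    using y(2) by (auto simp: shifted_upper_image_def)
  have "mocp_objective G (s *\<^sub>R x1 + t *\<^sub>R x2) =
      s *\<^sub>R mocp_objective G x1 + t *\<^sub>R mocp_objective G x2"
    by (simp add: linear_add[OF linear_mocp_objective] linear_cmul[OF linear_mocp_objective])
  also have "\<dots> \<le> s *\<^sub>R (y1 + \<epsilon> *\<^sub>R 1) + t *\<^sub>R (y2 + \<epsilon> *\<^sub>R 1)"
    using x1(2) x2(2) st by (intro add_mono scaleR_left_mono) auto
  also have "\<dots> = s *\<^sub>R y1 + t *\<^sub>R y2 + (s + t) *\<^sub>R \<epsilon> *\<^sub>R 1"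
    by (simp only: scaleR_add_left scaleR_add_right ac_simps)
  also have "\<dots> = s *\<^sub>R y1 + t *\<^sub>R y2 + \<epsilon> *\<^sub>R 1"
    using st by simp
  finally show "s *\<^sub>R y1 + t *\<^sub>R y2 \<in> shifted_upper_image G g \<epsilon>"
    using convexD[OF assms x1(1) x2(1) st] by (auto simp: shifted_upper_image_def)
qed

section \<open>Invariants of the algorithm\<close>

lemma ideal_point_le:
  assumes "compact (feasible_set g)" and x: "x \<in> feasible_set g"
  shows "ideal_point G g \<le> mocp_objective G x"
proof -
  have "ideal_point G g $ i \<le> mocp_objective G x $ i" for i
  proof -
    let ?T = "(\<lambda>x. mocp_objective G x $ i) ` feasible_set g"
    have "compact ((\<lambda>y. y $ i) ` mocp_objective G ` feasible_set g)"
      by (intro compact_continuous_image compact_mocp_image assms continuous_intros)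
    then have "compact ?T"
      by (simp add: image_image)
    then obtain t where t: "t \<in> ?T" "\<And>s. s \<in> ?T \<Longrightarrow> t \<le> s"
      using compact_attains_inf[of ?T] x by blast
    have "(LEAST t. t \<in> ?T) = t"
      using t by (rule Least_equality)
    then show ?thesis
      using t(2) x by (simp add: ideal_point_def)
  qed
  then show ?thesis
    by (simp add: less_eq_vec_def)
qed

lemma initial_outer_eq: "initial_outer G g = {y. ideal_point G g \<le> y}"
proof (intro set_eqI iffI)
  fix y assume "y \<in> {y. ideal_point G g \<le> y}"
  then show "y \<in> initial_outer G g"
    unfolding initial_outer_def
    by (auto intro!: exI[of _ "y - ideal_point G g"])
qed (auto simp: initial_outer_def)

lemma benson_reachable_closed_convex:
  assumes "benson_reachable G g \<epsilon> V P"
  shows "closed P \<and> convex P"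
  using assms
proof (induction rule: benson_reachable.induct)
  case init
  have eq: "initial_outer G g = {y. \<forall>i. ideal_point G g $ i \<le> y $ i}"
    by (simp add: initial_outer_eq less_eq_vec_def)
  have "closed (initial_outer G g)"
    unfolding eq by (intro closed_Collect_all closed_Collect_le continuous_intros)
  moreover have "convex (initial_outer G g)"
    unfolding eq using convex_real_interval(1)[unfolded atLeast_def]
    by (rule convex_box_cart[where P = "\<lambda>i t. ideal_point G g $ i \<le> t"])
  ultimately show ?case ..
next
  case (cut V P v x z u w)
  then show ?case
    unfolding supporting_halfspace_def
    by (auto intro!: closed_Int convex_Int closed_halfspace_ge convex_halfspace_ge)
qed auto

lemma benson_reachable_bounded_below:
  assumes "benson_reachable G g \<epsilon> V P" and "y \<in> P"
  shows "ideal_point G g \<le> y"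
  using assms by (induction arbitrary: y rule: benson_reachable.induct) (auto simp: initial_outer_eq)

lemma mocp_image_subset_reachable:
  assumes "benson_reachable G g \<epsilon> V P" and "compact (feasible_set g)"
  shows "mocp_objective G ` feasible_set g \<subseteq> P"
  using assms(1)
proof (induction rule: benson_reachable.induct)
  case init
  then show ?case
    using ideal_point_le[OF assms(2)] by (auto simp: initial_outer_eq)
next
  case (cut V P v x z u w)
  have "compact ((\<lambda>y. w \<bullet> y) ` mocp_objective G ` feasible_set g)"
    by (intro compact_continuous_image compact_mocp_image assms(2) continuous_intros)
  \<comment> \<open>boundedness below is what gives the real-valued infimum in the cut its intended meaning\<close>
  then have "bdd_below ((\<lambda>x. w \<bullet> mocp_objective G x) ` feasible_set g)"
    by (simp add: image_image compact_imp_bounded bounded_imp_bdd_below)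
  then show ?case
    using cut.IH by (auto simp: supporting_halfspace_def intro: cINF_lower)
qed auto

lemma accepted_in_shifted_upper_image:
  assumes "benson_reachable G g \<epsilon> V P"
  shows "V \<subseteq> shifted_upper_image G g \<epsilon>"
  using assms
proof (induction rule: benson_reachable.induct)
  case (accept V P v x z u w)
  have "P2_feasible G g v (x, z)"
    using accept.hyps by (simp add: P2_optimal_def is_arg_min_def)
  then have x: "x \<in> feasible_set g" and *: "mocp_objective G x - z *\<^sub>R 1 - v \<le> 0"
    by (auto simp: P2_feasible_def feasible_set_def)
  have "mocp_objective G x $ i \<le> v $ i + \<epsilon>" for i
    using *[unfolded less_eq_vec_def, rule_format, of i] \<open>\<not> z > \<epsilon>\<close> by simp
  then have "mocp_objective G x \<le> v + \<epsilon> *\<^sub>R 1"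
    by (simp add: less_eq_vec_def)
  then show ?case
    using accept.IH x by (auto simp: shifted_upper_image_def)
qed auto

lemma benson_result_subset_shifted_upper_image:
  assumes "benson_result G g \<epsilon> P" and "compact (feasible_set g)" and "convex (feasible_set g)"
  shows "P \<subseteq> shifted_upper_image G g \<epsilon>"
proof -
  obtain V where V: "benson_reachable G g \<epsilon> V P" "vertices P \<subseteq> V"
    using assms(1) by (auto simp: benson_result_def)
  show ?thesis
  proof (rule subset_if_extreme_points_subset)
    show "closed P" "convex P"
      using benson_reachable_closed_convex[OF V(1)] by auto
    show "ideal_point G g \<le> y" if "y \<in> P" for y
      using benson_reachable_bounded_below[OF V(1) that] .
    show "closed (shifted_upper_image G g \<epsilon>)" "convex (shifted_upper_image G g \<epsilon>)"
      using closed_shifted_upper_image convex_shifted_upper_image assms by blast+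
    show "ideal_point G g - \<epsilon> *\<^sub>R 1 \<le> y"
      if y: "y \<in> shifted_upper_image G g \<epsilon>" for y
    proof -
      obtain x where x: "x \<in> feasible_set g" "mocp_objective G x \<le> y + \<epsilon> *\<^sub>R 1"
        using y by (auto simp: shifted_upper_image_def)
      have "ideal_point G g \<le> mocp_objective G x"
        using assms(2) x(1) by (rule ideal_point_le)
      also note x(2)
      finally show ?thesis
        by (simp only: diff_le_eq)
    qed
    show "y' \<in> shifted_upper_image G g \<epsilon>"
      if y: "y \<in> shifted_upper_image G g \<epsilon>" and "y \<le> y'" for y y'
    proof -
      obtain x where x: "x \<in> feasible_set g" "mocp_objective G x \<le> y + \<epsilon> *\<^sub>R 1"
        using y by (auto simp: shifted_upper_image_def)
      note x(2)
      also have "y + \<epsilon> *\<^sub>R 1 \<le> y' + \<epsilon> *\<^sub>R 1"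
        using \<open>y \<le> y'\<close> by (rule add_right_mono)
      finally show ?thesis
        using x(1) by (auto simp: shifted_upper_image_def)
    qed
    show "v \<in> shifted_upper_image G g \<epsilon>" if "v extreme_point_of P" for v
      using that V accepted_in_shifted_upper_image[OF V(1)] by (auto simp: vertices_def)
  qed
qed

section \<open>The error bound\<close>

text \<open>
  With \<open>s = d + \<epsilon> e \<ge> 0\<close> and \<open>S\<close> the sum of the first \<open>q\<close> coordinates of \<open>s\<close>, one has
  \<open>S \<le> (q + 1) \<epsilon>\<close>, and the squared norm is at most \<open>S\<^sup>2 - 2 \<epsilon> S + q \<epsilon>\<^sup>2\<close>, because a sum of
  squares of nonnegative numbers is at most the square of their sum. For \<open>0 \<le> S \<le> (q + 1) \<epsilon>\<close>
  this quadratic in \<open>S\<close> is largest at the right end point.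
\<close>

lemma norm_omit_last_le:
  fixes d :: "real ^ ('q::finite) option"
  assumes "0 \<le> \<epsilon>" and d: "\<And>i. - \<epsilon> \<le> d $ i" and "d \<in> sum_zero_hyperplane"
  shows "norm (omit_last d) \<le> \<epsilon> * sqrt (real CARD('q) ^ 2 + real CARD('q) - 1)"
proof -
  let ?q = "real CARD('q)"
  define s where "s i = d $ Some i + \<epsilon>" for i
  define S where "S = (\<Sum>i\<in>UNIV. s i)"
  have s: "0 \<le> s i" for i
    using d[of "Some i"] by (simp add: s_def)
  then have "0 \<le> S"
    by (simp add: S_def sum_nonneg)
  have q: "1 \<le> ?q"
    using zero_less_card_finite[where 'a='q] by linarith
  have "d $ None + (\<Sum>i\<in>UNIV. d $ Some i) = 0"
    using assms(3) by (simp add: sum_zero_hyperplane_def inner_one sum_UNIV_option)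
  then have S: "S \<le> (?q + 1) * \<epsilon>"
    using d[of None] by (simp add: S_def s_def sum.distrib algebra_simps)
  have sq: "(\<Sum>i\<in>UNIV. (s i)\<^sup>2) \<le> S\<^sup>2"
  proof -
    have "(\<Sum>i\<in>UNIV. (s i)\<^sup>2) \<le> (\<Sum>i\<in>UNIV. s i * S)"
      unfolding power2_eq_square S_def
      by (intro sum_mono mult_left_mono member_le_sum) (use s in auto)
    then show ?thesis
      by (simp add: S_def sum_distrib_right power2_eq_square)
  qed
  have "S * (S - 2 * \<epsilon>) \<le> ((?q + 1) * \<epsilon>) * ((?q - 1) * \<epsilon>)"
  proof -
    have "S * (S - 2 * \<epsilon>) \<le> S * ((?q - 1) * \<epsilon>)"
      using S \<open>0 \<le> S\<close> by (intro mult_left_mono) (auto simp: algebra_simps)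
    also have "\<dots> \<le> ((?q + 1) * \<epsilon>) * ((?q - 1) * \<epsilon>)"
      using S q \<open>0 \<le> \<epsilon>\<close> by (intro mult_right_mono) auto
    finally show ?thesis .
  qed
  moreover have "(norm (omit_last d))\<^sup>2 = (\<Sum>i\<in>UNIV. (s i)\<^sup>2) - 2 * \<epsilon> * S + ?q * \<epsilon>\<^sup>2"
  proof -
    have "(norm (omit_last d))\<^sup>2 = (\<Sum>i\<in>UNIV. (s i - \<epsilon>)\<^sup>2)"
      unfolding power2_norm_eq_inner
      by (simp add: inner_vec_def omit_last_def s_def power2_eq_square)
    also have "\<dots> = (\<Sum>i\<in>UNIV. (s i)\<^sup>2 - 2 * \<epsilon> * s i + \<epsilon>\<^sup>2)"
      by (simp add: power2_diff algebra_simps)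
    finally show ?thesis
      by (simp add: S_def sum.distrib sum_subtractf sum_distrib_left)
  qed
  ultimately have "(norm (omit_last d))\<^sup>2 \<le> \<epsilon>\<^sup>2 * (?q\<^sup>2 + ?q - 1)"
    using sq by (simp add: algebra_simps power2_eq_square)
  then have "norm (omit_last d) \<le> sqrt (\<epsilon>\<^sup>2 * (?q\<^sup>2 + ?q - 1))"
    by (rule real_le_rsqrt)
  then show ?thesis
    using \<open>0 \<le> \<epsilon>\<close> by (simp add: real_sqrt_mult)
qed

lemma hausdorff_distance_le_if_subset:
  assumes "B \<subseteq> A" and "\<And>a. a \<in> A \<Longrightarrow> \<exists>b\<in>B. dist a b \<le> r"
  shows "hausdorff_distance A B \<le> ennreal r"
proof -
  have "(INF b\<in>B. ennreal (dist a b)) \<le> ennreal r" if "a \<in> A" for a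
    using assms(2)[OF that] by (meson INF_lower2 ennreal_leI)
  moreover have "(INF a\<in>A. ennreal (dist a b)) \<le> ennreal r" if "b \<in> B" for b
  proof -
    have "(INF a\<in>A. ennreal (dist a b)) \<le> ennreal (dist b b)"
      using assms(1) that by (intro INF_lower) auto
    then show ?thesis by simp
  qed
  ultimately show ?thesis
    by (auto simp: hausdorff_distance_def intro!: SUP_least)
qed

theorem theorem8:
  fixes G :: "real ^ 'n ^ 'q"
    and g :: "'m::finite \<Rightarrow> real ^ 'n \<Rightarrow> ereal"
    and \<epsilon> :: real
    and P_outer :: "(real ^ ('q::finite) option) set"
    and Y_outer :: "(real ^ 'q) set"
  assumes "is_CPP G g"
    and "\<epsilon> > 0"
    and "benson_result G g \<epsilon> P_outer"
    and "Y_outer = omit_last ` (P_outer \<inter> sum_zero_hyperplane)"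
  shows "Y_outer \<supseteq> projected_set G g \<and>
    hausdorff_distance Y_outer (projected_set G g)
      \<le> ennreal (\<epsilon> * sqrt (real CARD('q) ^ 2 + real CARD('q) - 1))"
proof
  have X: "compact (feasible_set g)" "convex (feasible_set g)"
    using assms(1) by (auto simp: is_CPP_def convex_body_def)
  obtain V where "benson_reachable G g \<epsilon> V P_outer"
    using assms(3) by (auto simp: benson_result_def)
  then have "mocp_objective G ` feasible_set g \<subseteq> P_outer"
    using X(1) by (rule mocp_image_subset_reachable)
  then show sub: "projected_set G g \<subseteq> Y_outer"
    unfolding projected_set_def assms(4) omit_last_mocp_objective[symmetric]
    using mocp_objective_in_hyperplane by blast
  show "hausdorff_distance Y_outer (projected_set G g)
      \<le> ennreal (\<epsilon> * sqrt (real CARD('q) ^ 2 + real CARD('q) - 1))"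
  proof (rule hausdorff_distance_le_if_subset[OF sub])
    fix a assume "a \<in> Y_outer"
    then obtain y where y: "y \<in> P_outer" "y \<in> sum_zero_hyperplane" and a: "a = omit_last y"
      using assms(4) by blast
    obtain x where x: "x \<in> feasible_set g" and le: "mocp_objective G x \<le> y + \<epsilon> *\<^sub>R 1"
      using benson_result_subset_shifted_upper_image[OF assms(3) X] y(1)
      by (auto simp: shifted_upper_image_def)
    let ?d = "y - mocp_objective G x"
    have "- \<epsilon> \<le> ?d $ i" for i
      using le[unfolded less_eq_vec_def, rule_format, of i] by simp
    moreover have "?d \<in> sum_zero_hyperplane"
      using y(2) mocp_objective_in_hyperplane[of G x]
      by (simp add: sum_zero_hyperplane_def inner_diff_right)
    ultimately have "norm (omit_last ?d)
        \<le> \<epsilon> * sqrt (real CARD('q) ^ 2 + real CARD('q) - 1)"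
      using assms(2) by (intro norm_omit_last_le) auto
    moreover have "omit_last ?d = a - G *v x"
      unfolding a omit_last_mocp_objective[symmetric] by (simp add: omit_last_def vec_eq_iff)
    ultimately show "\<exists>b\<in>projected_set G g. dist a b
        \<le> \<epsilon> * sqrt (real CARD('q) ^ 2 + real CARD('q) - 1)"
      using x by (auto simp: projected_set_def dist_norm)
  qed
qed

end
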